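(* For all $n\geq1$, \[ P_{n}^{(\mathrm{pk},\mathrm{ipk})}(s,t) = \frac{1}{n!}\sum_{k=0}^n d(n,k) \left((1-s)(1-t)\right)^{\frac{n-k}{2}}P_{k}^{\mathrm{pk}}(s)P_{k}^{\mathrm{pk}}(t), \] where $P_{n}^{(\mathrm{pk},\mathrm{ipk})}(s,t)=\sum_{\pi\in\mathfrak{S}_{n}}s^{\mathrm{pk}(\pi)+1}t^{\mathrm{ipk}(\pi)+1}$. (Since $d(n,k)=0$ when $n-k$ is odd, no square roots actually occur.)
   Context: $\mathfrak{S}_n$ is the symmetric group on $[n]$. For $\pi\in\mathfrak{S}_n$, an index $i$ with $2\le i\le n-1$ is a peak if $\pi(i-1)<\pi(i)>\pi(i+1)$; $\mathrm{pk}(\pi)$ is the number of peaks and $\mathrm{ipk}(\pi)=\mathrm{pk}(\pi^{-1})$. The peak polynomials are $P_n^{\mathrm{pk}}(t)=\sum_{\pi\in\mathfrak{S}_n}t^{\mathrm{pk}(\pi)+1}$ for $n\ge1$ and $P_0^{\mathrm{pk}}(t)=1$. $d(n,k)$ is the number of permutations in $\mathfrak{S}_n$ with exactly $k$ cycles, all of odd length (with $d(0,0)=1$). *)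

theory Defs
  imports
    "HOL-Combinatorics.Permutations"
    "HOL-Combinatorics.Orbits"
    "HOL-Computational_Algebra.Polynomial"
begin

definition peaks :: "nat \<Rightarrow> (nat \<Rightarrow> nat) \<Rightarrow> nat set" where
  "peaks n \<pi> = {i \<in> {2..n - 1}. \<pi> (i - 1) < \<pi> i \<and> \<pi> i > \<pi> (i + 1)}"

definition pk :: "nat \<Rightarrow> (nat \<Rightarrow> nat) \<Rightarrow> nat" where
  "pk n \<pi> = card (peaks n \<pi>)"

definition ipk :: "nat \<Rightarrow> (nat \<Rightarrow> nat) \<Rightarrow> nat" where
  "ipk n \<pi> = pk n (inv \<pi>)"

text \<open>Polynomials are written as expressions in ring elements; the formal polynomials arise
  by inserting the indeterminates defined below.\<close>

definition peak_poly :: "nat \<Rightarrow> 'a::comm_semiring_1 \<Rightarrow> 'a" where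
  "peak_poly n t = (if n = 0 then 1 else (\<Sum>\<pi> | \<pi> permutes {1..n}. t ^ (pk n \<pi> + 1)))"

definition pk_ipk_poly :: "nat \<Rightarrow> 'a::comm_semiring_1 \<Rightarrow> 'a \<Rightarrow> 'a" where
  "pk_ipk_poly n s t =
     (\<Sum>\<pi> | \<pi> permutes {1..n}. s ^ (pk n \<pi> + 1) * t ^ (ipk n \<pi> + 1))"

text \<open>The cycles of a permutation are identified with their underlying sets; a fixed point
  is a cycle of length 1.\<close>

definition cycle_sets :: "nat \<Rightarrow> (nat \<Rightarrow> nat) \<Rightarrow> nat set set" where
  "cycle_sets n \<pi> = orbit \<pi> ` {1..n}"

definition odd_cycle_number :: "nat \<Rightarrow> nat \<Rightarrow> nat" where
  "odd_cycle_number n k =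
     card {\<pi>. \<pi> permutes {1..n} \<and> card (cycle_sets n \<pi>) = k \<and>
              (\<forall>C \<in> cycle_sets n \<pi>. odd (card C))}"

text \<open>The indeterminates of \<open>\<rat>[s][t] = \<rat>[s, t]\<close>.\<close>

definition var_s :: "rat poly poly" where
  "var_s = [:[:0, 1:]:]"

definition var_t :: "rat poly poly" where
  "var_t = [:0, 1:]"

end

theory Submission
  imports Defs "HOL-Computational_Algebra.Polynomial_FPS"
begin

text \<open>
  Encode the signed letters \<open>-1 < 1 < -2 < 2 < \<dots>\<close> of Stembridge's enriched \<open>P\<close>-partitions
  by the naturals \<open>0 < 1 < 2 < 3 < \<dots>\<close>, so that odd letters are the positive ones, and let
  \<open>\<Omega>\<^sub>\<pi>(i)\<close> be the number of enriched \<open>\<pi>\<close>-partitions with letters below \<open>2i\<close>.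

  \<^item> Standardization of words shows \<open>\<Sum>\<^sub>\<pi> \<Omega>\<^sub>\<pi>(i) = (2i)\<^sup>n\<close>. Applied to one row of a two-rowed array
    whose columns are then read as single letters, it shows that the sum of
    \<open>\<Omega>\<^sub>\<pi>(i) \<Omega>\<^sub>\<sigma>(j)\<close> over all \<open>\<pi>\<close>, where \<open>\<sigma>\<close> is the inverse of \<open>\<pi>\<close>, equals \<open>\<Omega>\<^bsub>id\<^esub>(2ij)\<close>.
  \<^item> With \<open>r = (1+X)/(1-X)\<close> and \<open>S = 4X/(1+X)\<^sup>2\<close>, the power series with coefficients
    \<open>\<Omega>\<^sub>\<pi>(i)\<close> is \<open>r\<^bsup>n+1\<^esup> S\<^bsup>pk \<pi> + 1\<^esup> / 2\<close>, and \<open>1 - S = r\<^bsup>-2\<^esup>\<close>.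
  \<^item> \<open>\<Omega>\<^bsub>id\<^esub>(m)\<close> is the coefficient of \<open>x\<^sup>n\<close> in \<open>((1+x)/(1-x))\<^sup>m\<close>, that is
    \<open>1/n! \<Sum>\<^sub>k d(n,k) (2m)\<^sup>k\<close>. At \<open>m = 2ij\<close> the factor \<open>(2m)\<^sup>k\<close> splits as \<open>(2i)\<^sup>k (2j)\<^sup>k\<close>.

  Comparing generating functions, first in \<open>i\<close> and then in \<open>j\<close>, and cancelling the powers of \<open>r\<close>
  gives the identity at \<open>S\<close>, hence as an identity of polynomials.
\<close>

section \<open>Enriched partitions and standardization\<close>

definition enriched :: "(nat \<Rightarrow> nat) \<Rightarrow> nat \<Rightarrow> nat \<Rightarrow> (nat \<Rightarrow> nat) set" where
  "enriched \<pi> n K = {f \<in> {1..n} \<rightarrow>\<^sub>E {..<K}. \<forall>k\<in>{1..<n}.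
     f k < f (Suc k) \<or> f k = f (Suc k) \<and> (odd (f k) \<longleftrightarrow> \<pi> k < \<pi> (Suc k))}"

fun enriched_count :: "(nat \<Rightarrow> nat) \<Rightarrow> nat \<Rightarrow> nat \<Rightarrow> nat" where
  "enriched_count \<pi> 0 K = 1"
| "enriched_count \<pi> (Suc n) K =
     (\<Sum>v<K. enriched_count \<pi> n (if odd v \<longleftrightarrow> \<pi> n < \<pi> (Suc n) then Suc v else v))"

lemma finite_enriched [simp]: "finite (enriched \<pi> n K)"
  unfolding enriched_def by (rule finite_subset[of _ "{1..n} \<rightarrow>\<^sub>E {..<K}"]) (auto intro: finite_PiE)

lemma enrichedD:
  assumes "f \<in> enriched \<pi> n K" "1 \<le> k" "k < n"
  shows "f k < f (Suc k) \<or> f k = f (Suc k) \<and> (odd (f k) \<longleftrightarrow> \<pi> k < \<pi> (Suc k))"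
  using assms by (auto simp: enriched_def)

text \<open>Values increase weakly, so an earlier letter equal to the last one forces the letter at
  position \<open>n\<close> to equal it as well. Hence the condition at position \<open>n\<close>
  governs every earlier letter.\<close>

lemma enriched_le_last:
  assumes "f \<in> enriched \<pi> (Suc n) K" "1 \<le> k" "k \<le> n"
  shows "f k < f (Suc n) \<or> f k = f (Suc n) \<and> (odd (f (Suc n)) \<longleftrightarrow> \<pi> n < \<pi> (Suc n))"
proof -
  have "f k \<le> f m" if "k \<le> m" "m \<le> n" for m
    using that
  proof (induction m rule: dec_induct)
    case (step m)
    then show ?case using enrichedD[OF assms(1), of m] assms by fastforce
  qed simp
  from this[of n] show ?thesis using enrichedD[OF assms(1), of n] assms by fastforce
qed

lemma card_enriched: "card (enriched \<pi> n K) = enriched_count \<pi> n K"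
proof (induction n arbitrary: K)
  case 0
  then show ?case by (auto simp: enriched_def)
next
  case (Suc n)
  \<comment> \<open>Exclusive bound on the earlier letters when the last letter is \<open>v\<close>;
    it admits \<open>v\<close> itself exactly when \<open>v\<close> may be repeated at the
    end.\<close>
  define b where "b = (\<lambda>v. if odd v \<longleftrightarrow> \<pi> n < \<pi> (Suc n) then Suc v else v)"
  have less_b: "w < b v \<longleftrightarrow> w < v \<or> w = v \<and> (odd v \<longleftrightarrow> \<pi> n < \<pi> (Suc n))" for w v
    by (auto simp: b_def)
  have "bij_betw (\<lambda>f. (f (Suc n), restrict f {1..n})) (enriched \<pi> (Suc n) K)
          (SIGMA v:{..<K}. enriched \<pi> n (b v))"
  proof (rule bij_betw_byWitness[where f' = "\<lambda>(v, f). f(Suc n := v)"], goal_cases)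
    case 1
    show ?case
      by (auto simp: enriched_def fun_eq_iff PiE_iff extensional_def)
  next
    case 2
    show ?case
      by (auto simp: enriched_def fun_eq_iff PiE_iff extensional_def)
  next
    case 3
    show ?case
    proof (intro image_subsetI SigmaI)
      fix f assume f: "f \<in> enriched \<pi> (Suc n) K"
      then show "f (Suc n) \<in> {..<K}" by (auto simp: enriched_def PiE_iff)
      show "restrict f {1..n} \<in> enriched \<pi> n (b (f (Suc n)))"
        using enrichedD[OF f] enriched_le_last[OF f]
        by (auto simp: enriched_def less_b)
    qed
  next
    case 4
    have "f(Suc n := v) \<in> enriched \<pi> (Suc n) K"
      if v: "v \<in> {..<K}" and f: "f \<in> enriched \<pi> n (b v)" for v f
    proof -
      have fb: "f k < b v" if "1 \<le> k" "k \<le> n" for k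
        using f that by (auto simp: enriched_def PiE_iff)
      have bv: "b v \<le> Suc v" by (simp add: b_def)
      have fK: "f k < K" if "1 \<le> k" "k \<le> n" for k
        using fb[OF that] bv v by auto
      show "f(Suc n := v) \<in> enriched \<pi> (Suc n) K"
        unfolding enriched_def
      proof (intro CollectI conjI ballI)
        show "f(Suc n := v) \<in> {1..Suc n} \<rightarrow>\<^sub>E {..<K}"
          using f v fK by (auto simp: enriched_def PiE_iff extensional_def)
        fix k assume k: "k \<in> {1..<Suc n}"
        show "(f(Suc n := v)) k < (f(Suc n := v)) (Suc k) \<or>
              (f(Suc n := v)) k = (f(Suc n := v)) (Suc k) \<and>
              (odd ((f(Suc n := v)) k) \<longleftrightarrow> \<pi> k < \<pi> (Suc k))"
          using k fb[of k] enrichedD[OF f, of k] by (cases "k = n") (auto simp: less_b)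
      qed
    qed
    then show ?case by auto
  qed
  then have "card (enriched \<pi> (Suc n) K) = card (SIGMA v:{..<K}. enriched \<pi> n (b v))"
    by (rule bij_betw_same_card)
  also have "\<dots> = (\<Sum>v<K. enriched_count \<pi> n (b v))"
    by (simp add: card_SigmaI Suc.IH)
  finally show ?case by (simp add: b_def)
qed

section \<open>Standardization of words in signed letters\<close>

definition word_less :: "(nat \<Rightarrow> nat) \<Rightarrow> nat \<Rightarrow> nat \<Rightarrow> bool" where
  "word_less h l m \<longleftrightarrow> h l < h m \<or> h l = h m \<and> (if odd (h l) then l < m else m < l)"

text \<open>The rank of a position under \<open>word_less\<close>. Ties are broken so that equal odd
  letters receive ranks rising from left to right and equal even letters falling ones. The clause
  \<open>l = m\<close> makes ranks start at 1.\<close>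

definition std :: "nat \<Rightarrow> (nat \<Rightarrow> nat) \<Rightarrow> nat \<Rightarrow> nat" where
  "std n h m = (if m \<in> {1..n} then card {l \<in> {1..n}. l = m \<or> word_less h l m} else m)"

lemma word_less_trans: "word_less h a b \<Longrightarrow> word_less h b c \<Longrightarrow> word_less h a c"
  by (auto simp: word_less_def split: if_splits)

lemma word_less_linear: "a = b \<or> word_less h a b \<or> word_less h b a"
  by (auto simp: word_less_def)

lemma not_word_less_self [simp]: "\<not> word_less h a a"
  by (auto simp: word_less_def)

text \<open>The sets of predecessors counted by \<open>std\<close> are strictly nested along
  \<open>word_less\<close>; the converse holds because \<open>word_less\<close> is linear.\<close>

lemma std_less_iff:
  assumes "l \<in> {1..n}" "m \<in> {1..n}"
  shows "std n h l < std n h m \<longleftrightarrow> word_less h l m"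
proof -
  have less: "std n h a < std n h b" if "a \<in> {1..n}" "b \<in> {1..n}" "word_less h a b" for a b
  proof -
    have "b \<notin> {l \<in> {1..n}. l = a \<or> word_less h l a}"
      using that word_less_trans[of h a b a] by auto
    moreover have "{l \<in> {1..n}. l = a \<or> word_less h l a} \<subseteq> {l \<in> {1..n}. l = b \<or> word_less h l b}"
      using that word_less_trans[of h _ a b] by auto
    ultimately have "{l \<in> {1..n}. l = a \<or> word_less h l a} \<subset> {l \<in> {1..n}. l = b \<or> word_less h l b}"
      using that by blast
    then have "card {l \<in> {1..n}. l = a \<or> word_less h l a} < card {l \<in> {1..n}. l = b \<or> word_less h l b}"
      by (intro psubset_card_mono) simp_all
    then show ?thesis using that by (simp only: std_def if_True)
  qed
  show ?thesis using less[of l m] less[of m l] word_less_linear[of l m h] assms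
    by (metis less_asym less_irrefl)
qed

lemma std_permutes: "std n h permutes {1..n}"
proof (rule bij_imp_permutes)
  have "inj_on (std n h) {1..n}"
    using std_less_iff[of _ n _ h] word_less_linear by (metis inj_onI less_irrefl)
  moreover have "std n h ` {1..n} \<subseteq> {1..n}"
  proof clarify
    fix m assume m: "m \<in> {1..n}"
    let ?A = "{l \<in> {1..n}. l = m \<or> word_less h l m}"
    have "card ?A \<le> n" using card_mono[of "{1..n}" ?A] by fastforce
    moreover have "card ?A > 0" using m by (subst card_gt_0_iff) auto
    ultimately show "std n h m \<in> {1..n}" using m unfolding std_def by (simp only: if_True) simp
  qed
  ultimately show "bij_betw (std n h) {1..n} {1..n}"
    by (simp add: bij_betw_def endo_inj_surj)
qed (auto simp: std_def)

text \<open>The word \<open>f \<circ> inv \<pi>\<close> carries the letter \<open>f k\<close> at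
  position \<open>\<pi> k\<close>, so the enriched condition makes consecutive positions
  \<open>\<pi> k\<close>, \<open>\<pi> (Suc k)\<close> increase in \<open>word_less\<close>.
  Transitivity does the rest.\<close>

lemma enriched_word_less:
  assumes "\<pi> permutes {1..n}" "f \<in> enriched \<pi> n K" "1 \<le> k" "k < l" "l \<le> n"
  shows "word_less (f \<circ> inv \<pi>) (\<pi> k) (\<pi> l)"
  using assms(4,5)
proof (induction l rule: less_induct)
  case (less l)
  have *: "word_less (f \<circ> inv \<pi>) (\<pi> m) (\<pi> (Suc m))" if "1 \<le> m" "m < n" for m
  proof -
    have "\<pi> m \<noteq> \<pi> (Suc m)" using permutes_inj[OF assms(1)] by (metis injD n_not_Suc_n)
    then show ?thesis
      using enrichedD[OF assms(2), of m] that
      by (auto simp: word_less_def permutes_inverses[OF assms(1)])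
  qed
  obtain m where m: "l = Suc m" "k \<le> m" using less.prems(1) by (cases l) auto
  show ?case
  proof (cases "k = m")
    case True
    then show ?thesis using *[of m] m less.prems assms(3) by (metis Suc_le_lessD)
  next
    case False
    then have "word_less (f \<circ> inv \<pi>) (\<pi> k) (\<pi> m)" using less.IH[of m] m less.prems by (metis Suc_leD le_neq_implies_less lessI)
    moreover have "word_less (f \<circ> inv \<pi>) (\<pi> m) (\<pi> (Suc m))" using *[of m] m less.prems assms(3) by (metis Suc_le_lessD order.trans)
    ultimately show ?thesis using word_less_trans m by blast
  qed
qed

text \<open>Since \<open>\<pi>\<close> lists the positions in increasing \<open>word_less\<close>
  order, position \<open>\<pi> k\<close> has rank \<open>k\<close>.\<close>

lemma std_enriched:
  assumes \<pi>: "\<pi> permutes {1..n}" and f: "f \<in> enriched \<pi> n K"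
  shows "std n (f \<circ> inv \<pi>) = inv \<pi>"
proof
  fix m
  show "std n (f \<circ> inv \<pi>) m = inv \<pi> m"
  proof (cases "m \<in> {1..n}")
    case False
    then show ?thesis
      using permutes_not_in[OF permutes_inv[OF \<pi>] False] by (simp only: std_def if_False)
  next
    case True
    define k where "k = inv \<pi> m"
    have k: "k \<in> {1..n}" "m = \<pi> k"
      using True permutes_in_image[OF permutes_inv[OF \<pi>], of m]
      by (auto simp: k_def permutes_inverses[OF \<pi>])
    have iff: "\<pi> l = \<pi> k \<or> word_less (f \<circ> inv \<pi>) (\<pi> l) (\<pi> k) \<longleftrightarrow> l \<le> k" if "l \<in> {1..n}" for l
    proof (cases l k rule: linorder_cases)
      case less
      then show ?thesis using enriched_word_less[OF \<pi> f, of l k] that k by simp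
    next
      case equal
      then show ?thesis by simp
    next
      case greater
      then have "word_less (f \<circ> inv \<pi>) (\<pi> k) (\<pi> l)"
        using enriched_word_less[OF \<pi> f, of k l] that k by simp
      then have "\<not> word_less (f \<circ> inv \<pi>) (\<pi> l) (\<pi> k)" "\<pi> l \<noteq> \<pi> k"
        using word_less_trans not_word_less_self by metis+
      then show ?thesis using greater by simp
    qed
    have "{l \<in> {1..n}. l = \<pi> k \<or> word_less (f \<circ> inv \<pi>) l (\<pi> k)} = \<pi> ` {1..k}"
    proof -
      have "{l \<in> {1..n}. l = \<pi> k \<or> word_less (f \<circ> inv \<pi>) l (\<pi> k)} =
            \<pi> ` {l \<in> {1..n}. \<pi> l = \<pi> k \<or> word_less (f \<circ> inv \<pi>) (\<pi> l) (\<pi> k)}"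
        (is "?L = \<pi> ` ?R")
      proof (intro set_eqI iffI)
        fix l assume l: "l \<in> ?L"
        then have "\<pi> (inv \<pi> l) = l" "inv \<pi> l \<in> {1..n}"
          by (simp_all only: permutes_inverses[OF \<pi>] permutes_in_image[OF permutes_inv[OF \<pi>]] mem_Collect_eq)
        then show "l \<in> \<pi> ` ?R" using l by (intro image_eqI[of _ _ "inv \<pi> l"]) auto
      next
        fix l assume "l \<in> \<pi> ` ?R"
        then show "l \<in> ?L" using permutes_in_image[OF \<pi>] by blast
      qed
      also have "{l \<in> {1..n}. \<pi> l = \<pi> k \<or> word_less (f \<circ> inv \<pi>) (\<pi> l) (\<pi> k)} = {1..k}"
        by (intro set_eqI) (use iff k(1) in force)
      finally show ?thesis .
    qed
    then have "std n (f \<circ> inv \<pi>) m = card (\<pi> ` {1..k})"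
      using True unfolding k(2) std_def by simp
    also have "\<dots> = k" by (simp add: card_image permutes_inj_on[OF \<pi>])
    finally show ?thesis by (simp add: k_def)
  qed
qed

text \<open>Reading the letters of a word in the order of their ranks gives an enriched partition,
  and \<open>f \<circ> inv \<pi>\<close> puts the letters back.\<close>

lemma card_std_fiber:
  assumes \<pi>: "\<pi> permutes {1..n}"
  shows "card {h \<in> {1..n} \<rightarrow>\<^sub>E {..<K}. std n h = inv \<pi>} = card (enriched \<pi> n K)"
proof (rule bij_betw_same_card, rule bij_betw_byWitness[where f = "\<lambda>h. h \<circ> \<pi>" and f' = "\<lambda>f. f \<circ> inv \<pi>"],
    goal_cases)
  case 1
  show ?case by (auto simp: fun_eq_iff permutes_inverses[OF \<pi>])
next
  case 2
  show ?case by (auto simp: fun_eq_iff permutes_inverses[OF \<pi>])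
next
  case 3
  show ?case
  proof clarify
    fix h assume h: "h \<in> {1..n} \<rightarrow>\<^sub>E {..<K}" and std: "std n h = inv \<pi>"
    show "h \<circ> \<pi> \<in> enriched \<pi> n K"
      unfolding enriched_def
    proof (intro CollectI conjI ballI)
      show "h \<circ> \<pi> \<in> {1..n} \<rightarrow>\<^sub>E {..<K}"
        using h permutes_in_image[OF \<pi>] permutes_not_in[OF \<pi>]
        by (auto simp: PiE_iff extensional_def)
      fix k assume k: "k \<in> {1..<n}"
      then have "std n h (\<pi> k) < std n h (\<pi> (Suc k))"
        by (simp add: std permutes_inverses[OF \<pi>])
      moreover have "\<pi> k \<in> {1..n}" "\<pi> (Suc k) \<in> {1..n}"
        using k by (auto simp only: permutes_in_image[OF \<pi>]) auto
      ultimately have "word_less h (\<pi> k) (\<pi> (Suc k))"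
        by (simp only: std_less_iff)
      then show "(h \<circ> \<pi>) k < (h \<circ> \<pi>) (Suc k) \<or>
        (h \<circ> \<pi>) k = (h \<circ> \<pi>) (Suc k) \<and> (odd ((h \<circ> \<pi>) k) \<longleftrightarrow> \<pi> k < \<pi> (Suc k))"
        by (auto simp: word_less_def split: if_splits)
    qed
  qed
next
  case 4
  show ?case
  proof clarify
    fix f assume f: "f \<in> enriched \<pi> n K"
    have "f \<in> {1..n} \<rightarrow>\<^sub>E {..<K}" using f by (simp add: enriched_def)
    then have "f \<circ> inv \<pi> \<in> {1..n} \<rightarrow>\<^sub>E {..<K}"
      using permutes_in_image[OF permutes_inv[OF \<pi>]] permutes_not_in[OF permutes_inv[OF \<pi>]]
      by (auto simp: PiE_iff extensional_def)
    then show "f \<circ> inv \<pi> \<in> {1..n} \<rightarrow>\<^sub>E {..<K} \<and> std n (f \<circ> inv \<pi>) = inv \<pi>"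
      using std_enriched[OF \<pi> f] by blast
  qed
qed

text \<open>Words are grouped by their standardization. The weight \<open>W\<close> makes room for a
  second row that depends on it.\<close>

lemma sum_enriched_std:
  fixes W :: "(nat \<Rightarrow> nat) \<Rightarrow> nat"
  shows "(\<Sum>\<pi> | \<pi> permutes {1..n}. card (enriched \<pi> n K) * W (inv \<pi>)) =
         (\<Sum>h \<in> {1..n} \<rightarrow>\<^sub>E {..<K}. W (std n h))"
proof -
  let ?S = "{\<pi>. \<pi> permutes {1..n}}" and ?H = "{1..n} \<rightarrow>\<^sub>E {..<K}"
  have "(\<Sum>h \<in> ?H. W (std n h)) = (\<Sum>\<tau> \<in> ?S. \<Sum>h \<in> {h \<in> ?H. std n h = \<tau>}. W (std n h))"
    using std_permutes by (intro sum.group[symmetric] finite_permutations finite_PiE) blast+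
  also have "\<dots> = (\<Sum>\<tau> \<in> ?S. card {h \<in> ?H. std n h = \<tau>} * W \<tau>)"
    by (intro sum.cong refl) simp
  also have "\<dots> = (\<Sum>\<pi> \<in> ?S. card {h \<in> ?H. std n h = inv \<pi>} * W (inv \<pi>))"
    by (rule sum_permutations_inverse)
  also have "\<dots> = (\<Sum>\<pi> \<in> ?S. card (enriched \<pi> n K) * W (inv \<pi>))"
    by (intro sum.cong refl) (simp only: card_std_fiber mem_Collect_eq)
  finally show ?thesis by simp
qed

lemma sum_enriched_count: "(\<Sum>\<pi> | \<pi> permutes {1..n}. enriched_count \<pi> n K) = K ^ n"
  using sum_enriched_std[of n K "\<lambda>_. 1"] by (simp add: card_PiE card_enriched)

section \<open>Two-rowed arrays read as words of columns\<close>

text \<open>An order isomorphism from columns onto numbers. A column may be repeated exactly when its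
  two letters have the same parity, and these are the columns with odd code, because \<open>K\<close> is even.\<close>

definition pair_code :: "nat \<Rightarrow> nat \<Rightarrow> nat \<Rightarrow> nat" where
  "pair_code K g a = g * K + (if odd g then a else K - 1 - a)"

lemma pair_code_div: "a < K \<Longrightarrow> pair_code K g a div K = g"
  by (simp add: pair_code_def div_eq_dividend_iff)

lemma pair_code_mod: "a < K \<Longrightarrow> pair_code K g a mod K = (if odd g then a else K - 1 - a)"
  by (simp add: pair_code_def)

lemma pair_code_less:
  assumes "a < K" "g < L"
  shows "pair_code K g a < K * L"
proof -
  have "pair_code K g a < Suc g * K" using assms by (auto simp: pair_code_def)
  also have "\<dots> \<le> L * K" using assms by (intro mult_right_mono) auto
  finally show ?thesis by (simp add: mult.commute)
qed

lemma pair_code_divmod: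
  assumes "w < K * L"
  shows "pair_code K (w div K) (if odd (w div K) then w mod K else K - 1 - w mod K) = w"
proof -
  have "w mod K < K" using assms by (metis gr0I mod_less_divisor mult_0 not_less_zero)
  then have "pair_code K (w div K) (if odd (w div K) then w mod K else K - 1 - w mod K) =
    w div K * K + w mod K"
    by (simp add: pair_code_def)
  then show ?thesis by simp
qed

text \<open>Codes compare \<open>g\<close> first, then \<open>a\<close> upwards for odd
  \<open>g\<close> and downwards for even \<open>g\<close>; as \<open>K\<close> is even,
  \<open>K - 1 - a\<close> has the parity opposite to \<open>a\<close>. The right-hand side is the
  enriched condition on \<open>g\<close>, with the ascents that \<open>std\<close> has between
  adjacent positions holding \<open>a\<close> and \<open>a'\<close>.\<close>

lemma pair_code_weak_less_iff:
  assumes "even K" "a < K" "a' < K"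
  shows "pair_code K g a < pair_code K g' a' \<or>
           pair_code K g a = pair_code K g' a' \<and> odd (pair_code K g a) \<longleftrightarrow>
         g < g' \<or> g = g' \<and> (odd g \<longleftrightarrow> a < a' \<or> a = a' \<and> odd a)"
proof (cases g g' rule: linorder_cases)
  case equal
  obtain d where d: "K = Suc (a + d)" using assms(2) less_iff_Suc_add by auto
  then have "odd (K - 1 - a) \<longleftrightarrow> even a" using assms(1) by simp
  moreover have "K - 1 - a < K - 1 - a' \<longleftrightarrow> a' < a" "K - 1 - a = K - 1 - a' \<longleftrightarrow> a = a'"
    using assms(2,3) by linarith+ 
  ultimately show ?thesis using equal assms by (cases "odd g") (auto simp: pair_code_def)
next
  case less
  have "pair_code K g a < pair_code K g' a'"
    using less pair_code_div[OF assms(2), of g] pair_code_div[OF assms(3), of g']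
    by (metis div_le_mono linorder_not_less)
  then show ?thesis using less by simp
next
  case greater
  have "pair_code K g' a' < pair_code K g a"
    using greater pair_code_div[OF assms(2), of g] pair_code_div[OF assms(3), of g']
    by (metis div_le_mono linorder_not_less)
  then show ?thesis using greater by simp
qed

text \<open>The identity has only ascents, so the right-hand side is its enriched condition for the
  word of codes.\<close>

lemma enriched_std_iff:
  assumes "even K" and h: "\<And>k. k \<in> {1..n} \<Longrightarrow> h k < K"
  shows "(\<forall>k\<in>{1..<n}. g k < g (Suc k) \<or> g k = g (Suc k) \<and> (odd (g k) \<longleftrightarrow> std n h k < std n h (Suc k)))
     \<longleftrightarrow> (\<forall>k\<in>{1..<n}. pair_code K (g k) (h k) < pair_code K (g (Suc k)) (h (Suc k)) \<or>
            pair_code K (g k) (h k) = pair_code K (g (Suc k)) (h (Suc k)) \<and> odd (pair_code K (g k) (h k)))"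
proof (rule ball_cong[OF refl])
  fix k assume k: "k \<in> {1..<n}"
  have "std n h k < std n h (Suc k) \<longleftrightarrow> h k < h (Suc k) \<or> h k = h (Suc k) \<and> odd (h k)"
    using k by (subst std_less_iff) (auto simp: word_less_def)
  moreover have "h k < K" "h (Suc k) < K" using h k by auto
  ultimately show "(g k < g (Suc k) \<or> g k = g (Suc k) \<and> (odd (g k) \<longleftrightarrow> std n h k < std n h (Suc k)))
     \<longleftrightarrow> (pair_code K (g k) (h k) < pair_code K (g (Suc k)) (h (Suc k)) \<or>
            pair_code K (g k) (h k) = pair_code K (g (Suc k)) (h (Suc k)) \<and> odd (pair_code K (g k) (h k)))"
    using pair_code_weak_less_iff[OF assms(1), of "h k" "h (Suc k)" "g k" "g (Suc k)"] by simp
qed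

text \<open>The left side counts arrays with an arbitrary row \<open>h\<close> and a row
  \<open>g\<close> enriched for \<open>std n h\<close>. Coding each column as one letter below
  \<open>K * L\<close> maps them bijectively to enriched partitions of the identity.\<close>

lemma sum_enriched_std_eq:
  assumes "even K"
  shows "(\<Sum>h \<in> {1..n} \<rightarrow>\<^sub>E {..<K}. card (enriched (std n h) n L)) = card (enriched (\<lambda>i. i) n (K * L))"
proof -
  define P where "P = (SIGMA h:{1..n} \<rightarrow>\<^sub>E {..<K}. enriched (std n h) n L)"
  define enc where "enc = (\<lambda>(h, g). \<lambda>k\<in>{1..n}. pair_code K (g k) (h k))"
  define dech where "dech = (\<lambda>w. \<lambda>k\<in>{1..n}. if odd (w k div K) then w k mod K else K - 1 - w k mod K)"
  define decg where "decg = (\<lambda>w. \<lambda>k\<in>{1..n}. w k div K)"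
  have "bij_betw enc P (enriched (\<lambda>i. i) n (K * L))"
  proof (rule bij_betw_byWitness[where f' = "\<lambda>w. (dech w, decg w)"], goal_cases)
    case 1
    have "(dech (enc (h, g)), decg (enc (h, g))) = (h, g)" if "(h, g) \<in> P" for h g
    proof -
      have hg: "h \<in> {1..n} \<rightarrow>\<^sub>E {..<K}" "g \<in> {1..n} \<rightarrow>\<^sub>E {..<L}"
        using that by (auto simp: P_def enriched_def)
      then have h: "h k < K" if "k \<in> {1..n}" for k using that by (auto simp: PiE_iff)
      then have "K - Suc (K - Suc (h k)) = h k" if "Suc 0 \<le> k" "k \<le> n" for k
      proof -
        have "h k < K" using h that by simp
        then show ?thesis by simp
      qed
      then show ?thesis using hg h
        by (auto simp: dech_def decg_def enc_def fun_eq_iff pair_code_div pair_code_mod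
            PiE_iff extensional_def restrict_def)
    qed
    then show ?case by auto
  next
    case 2
    have "enc (dech w, decg w) = w" if w: "w \<in> enriched (\<lambda>i. i) n (K * L)" for w
    proof
      fix k
      have "w \<in> {1..n} \<rightarrow>\<^sub>E {..<K * L}" using w by (simp add: enriched_def)
      then show "enc (dech w, decg w) k = w k"
        using pair_code_divmod[of "w k" K L]
        by (cases "k \<in> {1..n}") (auto simp: enc_def dech_def decg_def PiE_iff extensional_def)
    qed
    then show ?case by blast
  next
    case 3
    have "enc (h, g) \<in> enriched (\<lambda>i. i) n (K * L)" if hg: "(h, g) \<in> P" for h g
    proof -
      have h: "h k < K" if "k \<in> {1..n}" for k
        using hg that by (auto simp: P_def PiE_iff)
      have g: "g k < L" if "k \<in> {1..n}" for k
        using hg that by (auto simp: P_def enriched_def PiE_iff)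
      show ?thesis
        using hg enriched_std_iff[of K n h g, OF assms h] pair_code_less[OF h g]
        by (auto simp: enriched_def P_def enc_def)
    qed
    then show ?case by auto
  next
    case 4
    have "(dech w, decg w) \<in> P" if w: "w \<in> enriched (\<lambda>i. i) n (K * L)" for w
    proof -
      have wKL: "w k < K * L" if "k \<in> {1..n}" for k
        using w that by (auto simp: enriched_def PiE_iff)
      have h: "dech w k < K" if "k \<in> {1..n}" for k
      proof -
        have "K > 0" using wKL[OF that] by (cases K) auto
        then show ?thesis using that by (auto simp: dech_def)
      qed
      have g: "decg w k < L" if "k \<in> {1..n}" for k
        using that wKL[OF that] by (simp add: decg_def less_mult_imp_div_less mult.commute)
      have code: "pair_code K (decg w k) (dech w k) = w k" if "k \<in> {1..n}" for k
        using pair_code_divmod[OF wKL[OF that]] that by (simp add: decg_def dech_def)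
      have "\<forall>k\<in>{1..<n}. w k < w (Suc k) \<or> w k = w (Suc k) \<and> odd (w k)"
        using w by (auto simp: enriched_def)
      then have "\<forall>k\<in>{1..<n}. decg w k < decg w (Suc k) \<or>
          decg w k = decg w (Suc k) \<and> (odd (decg w k) \<longleftrightarrow> std n (dech w) k < std n (dech w) (Suc k))"
        by (subst enriched_std_iff[OF assms h]) (auto simp: code)
      moreover have "dech w \<in> {1..n} \<rightarrow>\<^sub>E {..<K}"
        using h by (auto simp: PiE_iff dech_def)
      moreover have "decg w \<in> {1..n} \<rightarrow>\<^sub>E {..<L}"
        using g by (auto simp: PiE_iff decg_def)
      ultimately show ?thesis by (simp add: P_def enriched_def)
    qed
    then show ?case by blast
  qed
  then have "card P = card (enriched (\<lambda>i. i) n (K * L))" by (rule bij_betw_same_card)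
  then show ?thesis by (simp add: P_def card_SigmaI finite_PiE)
qed

lemma sum_enriched_count_inv:
  assumes "even K"
  shows "(\<Sum>\<pi> | \<pi> permutes {1..n}. enriched_count \<pi> n K * enriched_count (inv \<pi>) n L) =
         enriched_count (\<lambda>i. i) n (K * L)"
  using sum_enriched_std[of n K "\<lambda>\<tau>. card (enriched \<tau> n L)"] sum_enriched_std_eq[OF assms, of n L]
  by (simp only: card_enriched)

section \<open>Generating functions by peak number\<close>

lemma enriched_count_0 [simp]: "n \<ge> 1 \<Longrightarrow> enriched_count \<pi> n 0 = 0"
  by (cases n) auto

definition even_gf :: "(nat \<Rightarrow> nat) \<Rightarrow> nat \<Rightarrow> rat fps" where
  "even_gf \<pi> n = Abs_fps (\<lambda>i. of_nat (enriched_count \<pi> n (2 * i)))"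

text \<open>Auxiliary series: one further negative letter is allowed. It arises because at a descent
  the recursion leads only to odd bounds.\<close>

definition odd_gf :: "(nat \<Rightarrow> nat) \<Rightarrow> nat \<Rightarrow> rat fps" where
  "odd_gf \<pi> n = Abs_fps (\<lambda>i. of_nat (enriched_count \<pi> n (Suc (2 * i))))"

definition cayley :: "rat fps" where
  "cayley = (1 + fps_X) * inverse (1 - fps_X)"

definition peak_arg :: "rat fps" where
  "peak_arg = 4 * fps_X * inverse ((1 + fps_X) ^ 2)"

lemma cayley_mult: "(1 - fps_X) * cayley = 1 + fps_X"
proof -
  have "inverse (1 - fps_X) * (1 - fps_X :: rat fps) = 1"
    by (rule inverse_mult_eq_1) simp
  then show ?thesis by (simp add: cayley_def mult.commute mult.left_commute)
qed

lemma peak_arg_mult: "(1 + fps_X) ^ 2 * peak_arg = 4 * fps_X"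
proof -
  have "inverse ((1 + fps_X) ^ 2) * ((1 + fps_X :: rat fps) ^ 2) = 1"
    by (rule inverse_mult_eq_1) simp
  then show ?thesis by (simp add: peak_arg_def mult.commute mult.left_commute)
qed

lemma one_minus_fps_X_nonzero [simp]: "1 - fps_X \<noteq> (0 :: rat fps)"
  by (metis fps_sub_nth fps_X_nth diff_zero fps_one_nth fps_zero_nth zero_neq_one)

lemma one_plus_fps_X_nonzero [simp]: "1 + fps_X \<noteq> (0 :: rat fps)"
  by (metis fps_add_nth fps_X_nth add_0_right fps_one_nth fps_zero_nth zero_neq_one)

text \<open>At an ascent the last letters \<open>2 * i\<close> and \<open>Suc (2 * i)\<close> leave
  the bounds \<open>2 * i\<close> and \<open>2 * i + 2\<close>, so only even bounds occur.\<close>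

lemma gf_ascent:
  assumes "n \<ge> 1" "\<pi> n < \<pi> (Suc n)"
  shows "(1 - fps_X) * even_gf \<pi> (Suc n) = (1 + fps_X) * even_gf \<pi> n"
    and "odd_gf \<pi> (Suc n) = even_gf \<pi> (Suc n) + even_gf \<pi> n"
proof -
  show "(1 - fps_X) * even_gf \<pi> (Suc n) = (1 + fps_X) * even_gf \<pi> n"
  proof (rule fps_ext)
    fix i
    show "fps_nth ((1 - fps_X) * even_gf \<pi> (Suc n)) i = fps_nth ((1 + fps_X) * even_gf \<pi> n) i"
      using assms by (cases i) (simp_all add: even_gf_def algebra_simps)
  qed
  show "odd_gf \<pi> (Suc n) = even_gf \<pi> (Suc n) + even_gf \<pi> n"
    using assms by (simp add: fps_eq_iff even_gf_def odd_gf_def)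
qed

text \<open>At a descent the last letters \<open>2 * i\<close> and \<open>Suc (2 * i)\<close> both
  leave the bound \<open>Suc (2 * i)\<close>.\<close>

lemma gf_descent:
  assumes "n \<ge> 1" "\<not> \<pi> n < \<pi> (Suc n)"
  shows "(1 - fps_X) * even_gf \<pi> (Suc n) = 2 * fps_X * odd_gf \<pi> n"
    and "odd_gf \<pi> (Suc n) = even_gf \<pi> (Suc n) + odd_gf \<pi> n"
proof -
  show "(1 - fps_X) * even_gf \<pi> (Suc n) = 2 * fps_X * odd_gf \<pi> n"
  proof (rule fps_ext)
    fix i
    show "fps_nth ((1 - fps_X) * even_gf \<pi> (Suc n)) i = fps_nth (2 * fps_X * odd_gf \<pi> n) i"
      using assms by (cases i) (simp_all add: even_gf_def odd_gf_def algebra_simps numeral_fps_const)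
  qed
  show "odd_gf \<pi> (Suc n) = even_gf \<pi> (Suc n) + odd_gf \<pi> n"
    using assms by (simp add: fps_eq_iff even_gf_def odd_gf_def)
qed

lemma pk_Suc:
  assumes "n \<ge> 1"
  shows "pk (Suc n) \<pi> =
    pk n \<pi> + (if n \<ge> 2 \<and> \<pi> (n - 1) < \<pi> n \<and> \<pi> (Suc n) < \<pi> n then 1 else 0)"
proof -
  let ?N = "if n \<ge> 2 \<and> \<pi> (n - 1) < \<pi> n \<and> \<pi> (Suc n) < \<pi> n then {n} else {}"
  have "peaks (Suc n) \<pi> = peaks n \<pi> \<union> ?N"
  proof (intro set_eqI)
    fix i
    show "i \<in> peaks (Suc n) \<pi> \<longleftrightarrow> i \<in> peaks n \<pi> \<union> ?N"
      using assms by (cases "i = n") (auto simp: peaks_def)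
  qed
  moreover have "finite (peaks n \<pi>)" "peaks n \<pi> \<inter> ?N = {}"
    by (auto simp: peaks_def)
  ultimately show ?thesis by (auto simp: pk_def card_Un_disjoint)
qed

lemma even_gf_1: "(1 - fps_X) ^ 2 * even_gf \<pi> 1 = 2 * fps_X"
proof -
  have "(1 - fps_X) * even_gf \<pi> 1 = 2 * fps_X * Abs_fps (\<lambda>_. 1)"
  proof (rule fps_ext)
    fix i
    show "fps_nth ((1 - fps_X) * even_gf \<pi> 1) i = fps_nth (2 * fps_X * Abs_fps (\<lambda>_. 1)) i"
      by (cases i) (simp_all add: even_gf_def algebra_simps numeral_fps_const)
  qed
  moreover have "(1 - fps_X) * Abs_fps (\<lambda>_. 1 :: rat) = 1"
    by (rule fps_ext) (simp add: algebra_simps)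
  ultimately show ?thesis by (simp add: power2_eq_square mult.assoc mult.left_commute)
qed

lemma even_gf_odd_gf_1: "2 * fps_X * odd_gf \<pi> 1 = (1 + fps_X) * even_gf \<pi> 1"
proof (rule fps_ext)
  fix i
  show "fps_nth (2 * fps_X * odd_gf \<pi> 1) i = fps_nth ((1 + fps_X) * even_gf \<pi> 1) i"
    by (cases i) (simp_all add: even_gf_def odd_gf_def algebra_simps numeral_fps_const)
qed

text \<open>The second conjunct strengthens the induction: the ratio of the odd to the even series
  depends only on whether the last step was an ascent, and \<open>n = 1\<close> behaves as after a
  descent. Injectivity replaces being a permutation because it passes to prefixes.\<close>

lemma even_gf_eq_aux:
  assumes "n \<ge> 1" "inj_on \<pi> {1..n}"
  shows "2 * even_gf \<pi> n = cayley ^ Suc n * peak_arg ^ Suc (pk n \<pi>) \<and>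
    (if n \<ge> 2 \<and> \<pi> (n - 1) < \<pi> n then (1 + fps_X) * odd_gf \<pi> n = 2 * even_gf \<pi> n
     else 2 * fps_X * odd_gf \<pi> n = (1 + fps_X) * even_gf \<pi> n)"
  using assms
proof (induction n rule: dec_induct)
  case base
  have "(1 - fps_X) ^ 2 * (cayley ^ 2 * peak_arg) = ((1 - fps_X) * cayley) ^ 2 * peak_arg"
    by (simp add: power_mult_distrib mult.assoc)
  also have "\<dots> = (1 - fps_X) ^ 2 * (2 * even_gf \<pi> 1)"
    using even_gf_1[of \<pi>] by (simp add: cayley_mult peak_arg_mult mult.left_commute)
  finally have "cayley ^ 2 * peak_arg = 2 * even_gf \<pi> 1" by simp
  moreover have "pk 1 \<pi> = 0" by (simp add: pk_def peaks_def)
  ultimately show ?case using even_gf_odd_gf_1[of \<pi>] by (simp add: power2_eq_square)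
next
  case (step n)
  define E where "E = even_gf \<pi> n"
  define E' where "E' = even_gf \<pi> (Suc n)"
  define Q where "Q = odd_gf \<pi> n"
  define Q' where "Q' = odd_gf \<pi> (Suc n)"
  have inj: "inj_on \<pi> {1..n}" using step.prems by (rule inj_on_subset) auto
  note IH = step.IH[OF inj, folded E_def Q_def]
  have ne: "\<pi> n \<noteq> \<pi> (Suc n)" using inj_onD[OF step.prems, of n "Suc n"] step.hyps by auto
  show ?case
  proof (cases "\<pi> n < \<pi> (Suc n)")
    case True
    note g = gf_ascent[of n \<pi>, OF step.hyps(1) True, folded E_def E'_def Q'_def]
    have "(1 - fps_X) * E' = (1 - fps_X) * (cayley * E)"
      using g(1) cayley_mult by (simp add: mult.assoc[symmetric])
    then have "E' = cayley * E" by simp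
    moreover have "(1 - fps_X) * ((1 + fps_X) * Q') = (1 - fps_X) * (2 * E')"
      using g by (simp add: algebra_simps)
    then have "(1 + fps_X) * Q' = 2 * E'" by (simp only: mult_cancel_left) simp
    moreover have "pk (Suc n) \<pi> = pk n \<pi>" using True step.hyps by (simp add: pk_Suc)
    ultimately show ?thesis using IH True step.hyps
      unfolding E'_def[symmetric] Q'_def[symmetric] by (simp add: mult.left_commute mult.assoc)
  next
    case False
    note g = gf_descent[of n \<pi>, OF step.hyps(1) False, folded E_def E'_def Q_def Q'_def]
    have "2 * fps_X * Q' = 2 * fps_X * E' + (1 - fps_X) * E'"
      using g by (simp add: distrib_left)
    then have 1: "2 * fps_X * Q' = (1 + fps_X) * E'" by (simp add: algebra_simps)
    show ?thesis
    proof (cases "n \<ge> 2 \<and> \<pi> (n - 1) < \<pi> n")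
      \<comment> \<open>A descent after an ascent creates a peak. Here \<open>4 * fps_X\<close>
        appears, which is \<open>(1 + fps_X) ^ 2 * peak_arg\<close>, so the step contributes the
        extra factor \<open>peak_arg\<close>.\<close>
      case True
      have "(1 + fps_X) * Q = 2 * E" using IH True by simp
      then have "4 * fps_X * E = 2 * fps_X * ((1 + fps_X) * Q)" by simp
      also have "\<dots> = (1 + fps_X) * ((1 - fps_X) * E')"
        unfolding g(1) by (simp only: mult_ac)
      finally have "((1 - fps_X) * (1 + fps_X)) * E' = (4 * fps_X) * E"
        by (simp only: mult_ac)
      also have "\<dots> = ((1 + fps_X) * ((1 - fps_X) * cayley)) * peak_arg * E"
        by (simp only: cayley_mult peak_arg_mult[symmetric] power2_eq_square)
      also have "\<dots> = ((1 - fps_X) * (1 + fps_X)) * (cayley * peak_arg * E)"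
        by (simp only: mult_ac)
      finally have "E' = cayley * peak_arg * E" by (simp only: mult_cancel_left) simp
      moreover have "pk (Suc n) \<pi> = Suc (pk n \<pi>)" using True False ne step.hyps by (simp add: pk_Suc)
      ultimately show ?thesis using IH False 1
        unfolding E'_def[symmetric] Q'_def[symmetric] by (simp add: mult.left_commute mult.assoc)
    next
      \<comment> \<open>A descent at the start or after a descent contributes only a factor
        \<open>cayley\<close>, just as an ascent does.\<close>
      case nasc: False
      have "2 * fps_X * Q = (1 + fps_X) * E" using IH nasc by argo
      then have "(1 - fps_X) * E' = (1 - fps_X) * (cayley * E)"
        using g(1) cayley_mult by (simp add: mult.assoc[symmetric])
      then have "E' = cayley * E" by simp
      moreover have "pk (Suc n) \<pi> = pk n \<pi>" using nasc step.hyps pk_Suc[of n \<pi>] by auto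
      ultimately show ?thesis using IH False 1
        unfolding E'_def[symmetric] Q'_def[symmetric] by (simp add: mult.left_commute mult.assoc)
    qed
  qed
qed

lemma even_gf_eq:
  assumes "n \<ge> 1" "\<pi> permutes {1..n}"
  shows "2 * even_gf \<pi> n = cayley ^ Suc n * peak_arg ^ Suc (pk n \<pi>)"
  using even_gf_eq_aux[OF assms(1) permutes_inj_on[OF assms(2)]] by blast

section \<open>Permutations with odd cycles\<close>

text \<open>Arbitrary ground sets allow any point to be removed without relabelling.\<close>

definition odd_cycle_perms :: "'a set \<Rightarrow> nat \<Rightarrow> ('a \<Rightarrow> 'a) set" where
  "odd_cycle_perms S k =
     {p. p permutes S \<and> card (orbit p ` S) = k \<and> (\<forall>C \<in> orbit p ` S. odd (card C))}"

text \<open>The added point is either fixed or begins a path to \<open>b\<close> and then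
  \<open>c\<close> in its cycle, with \<open>n\<close> choices of \<open>b\<close> and
  \<open>n - 1\<close> of \<open>c\<close>. Removing the added point and \<open>b\<close> shortens
  that cycle by two.\<close>

fun odd_cycle_rec :: "nat \<Rightarrow> nat \<Rightarrow> nat" where
  "odd_cycle_rec 0 k = (if k = 0 then 1 else 0)"
| "odd_cycle_rec (Suc n) k =
     (if k = 0 then 0 else odd_cycle_rec n (k - 1)) + n * (n - 1) * odd_cycle_rec (n - 1) k"

section \<open>Cycles under insertion of points\<close>

lemma orbit_eq_of_mem:
  assumes "p permutes S" "finite S" "x \<in> orbit p y"
  shows "orbit p x = orbit p y"
  using orbit_cyclic_eq3[OF cyclic_on_orbit[OF assms(1,2)] assms(3)] .

lemma orbit_self:
  assumes "p permutes S" "finite S"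
  shows "x \<in> orbit p x"
  by (rule permutation_self_in_orbit[OF permutes_imp_permutation[OF assms(2,1)]])

lemma permutes_insert_new:
  assumes "p permutes S" "b \<in> S"
  shows "transpose a b \<circ> p permutes insert a S"
proof (rule permutes_compose)
  show "p permutes insert a S" using assms(1) by (rule permutes_subset) auto
  show "transpose a b permutes insert a S" using assms(2) by (intro permutes_swap_id) auto
qed

text \<open>Composing with the transposition places \<open>a\<close> immediately before
  \<open>b\<close> in its cycle: \<open>a\<close> maps to \<open>b\<close>, and the former preimage
  of \<open>b\<close> maps to \<open>a\<close>.\<close>

lemma orbit_insert_new:
  assumes p: "p permutes S" and S: "finite S" "a \<notin> S" "b \<in> S"
  shows "orbit (transpose a b \<circ> p) a = insert a (orbit p b)"
proof -
  define q where "q = transpose a b \<circ> p"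
  have q: "q permutes insert a S" unfolding q_def by (rule permutes_insert_new[OF p S(3)])
  have qa: "q a = b" using permutes_not_in[OF p S(2)] by (simp add: q_def)
  have orbS: "orbit p b \<subseteq> S" by (rule permutes_orbit_subset[OF p S(3)])
  have qy: "q y = (if p y = b then a else p y)" if "y \<in> S" for y
    using permutes_in_image[OF p, of y] that S by (auto simp: transpose_def q_def)
  have b: "b \<in> orbit q a" using orbit.base[of q a] qa by simp
  have "y \<in> orbit q a" if "y \<in> orbit p b" for y
    using that
  proof (induction rule: orbit.induct)
    case base
    show ?case
      using orbit.step[OF b] qy[OF S(3)] b by (cases "p b = b") auto
  next
    case (step y)
    have "y \<in> S" using step.hyps orbS by blast
    then show ?case
      using orbit.step[OF step.IH] qy[of y] b by (cases "p y = b") auto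
  qed
  moreover have "a \<in> orbit q a" using orbit_self[OF q] S by simp
  moreover have "y \<in> insert a (orbit p b)" if "y \<in> orbit q a" for y
    using that
  proof (induction rule: orbit.induct)
    case base
    show ?case using qa orbit_self[OF p S(1)] by simp
  next
    case (step y)
    show ?case
    proof (cases "y = a")
      case True
      then show ?thesis using qa orbit_self[OF p S(1)] by simp
    next
      case False
      then have y: "y \<in> orbit p b" using step.IH by blast
      then have "y \<in> S" using orbS by blast
      then show ?thesis using qy[of y] orbit.step[OF y] by simp
    qed
  qed
  ultimately show ?thesis unfolding q_def by blast
qed

lemma orbits_insert_new:
  assumes p: "p permutes S" and S: "finite S" "a \<notin> S" "b \<in> S"
  shows "orbit (transpose a b \<circ> p) ` insert a S =
         insert (insert a (orbit p b)) (orbit p ` S - {orbit p b})"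
proof -
  let ?q = "transpose a b \<circ> p"
  have q: "?q permutes insert a S" by (rule permutes_insert_new[OF p S(3)])
  note qa = orbit_insert_new[OF assms]
  have in_b: "orbit ?q x = insert a (orbit p b)" if "orbit p x = orbit p b" for x
  proof -
    have "x \<in> orbit ?q a" using orbit_self[OF p S(1), of x] that qa by simp
    then have "orbit ?q x = orbit ?q a" using S by (intro orbit_eq_of_mem[OF q]) auto
    then show ?thesis using qa by (rule trans)
  qed
  have not_b: "orbit ?q x = orbit p x" if "x \<in> S" "orbit p x \<noteq> orbit p b" for x
  proof (rule orbit_cong)
    show "x \<in> orbit p x" by (rule orbit_self[OF p S(1)])
    fix s assume "s \<in> orbit p x"
    then have ps: "p s \<in> orbit p x" by (rule orbit.step)
    then have "p s \<noteq> b" using orbit_eq_of_mem[OF p S(1) ps] that by auto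
    moreover have "p s \<noteq> a" using ps permutes_orbit_subset[OF p that(1)] S by auto
    ultimately show "?q s = p s" by simp
  qed
  have "orbit ?q ` S = (\<lambda>x. if orbit p x = orbit p b then insert a (orbit p b) else orbit p x) ` S"
    using in_b not_b by (intro image_cong) simp_all
  also have "insert (insert a (orbit p b)) \<dots> =
      insert (insert a (orbit p b)) (orbit p ` S - {orbit p b})"
    by auto
  finally show ?thesis unfolding image_insert qa .
qed

text \<open>Inserting a new point into a cycle changes its parity, so points are inserted in pairs.\<close>

lemma orbits_insert_two:
  assumes p: "p permutes T" and T: "finite T" "b \<notin> T" "c \<in> T" and a: "a \<notin> T" "a \<noteq> b"
  shows "orbit (transpose a b \<circ> (transpose b c \<circ> p)) ` insert a (insert b T) =
         insert (insert a (insert b (orbit p c))) (orbit p ` T - {orbit p c})"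
proof -
  let ?q = "transpose b c \<circ> p"
  have q: "?q permutes insert b T" by (rule permutes_insert_new[OF p T(3)])
  have "insert b (orbit p c) \<notin> orbit p ` T"
    using permutes_orbit_subset[OF p] T(2) by auto
  then have "insert (insert b (orbit p c)) (orbit p ` T - {orbit p c}) - {insert b (orbit p c)} =
      orbit p ` T - {orbit p c}"
    by simp
  moreover have "orbit (transpose a b \<circ> ?q) ` insert a (insert b T) =
      insert (insert a (orbit ?q b)) (orbit ?q ` insert b T - {orbit ?q b})"
    using T a by (intro orbits_insert_new[OF q]) auto
  ultimately show ?thesis
    unfolding orbits_insert_new[OF p T] orbit_insert_new[OF p T] by simp
qed

text \<open>Only the cycle of \<open>c\<close> changes. It grows by two points, so the number of
  cycles and all parities are preserved.\<close>

lemma odd_cycle_perms_insert_two: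
  assumes p: "p permutes T" and T: "finite T" "b \<notin> T" "c \<in> T" and a: "a \<notin> T" "a \<noteq> b"
  shows "transpose a b \<circ> (transpose b c \<circ> p) \<in> odd_cycle_perms (insert a (insert b T)) k \<longleftrightarrow>
         p \<in> odd_cycle_perms T k"
proof -
  let ?q = "transpose a b \<circ> (transpose b c \<circ> p)"
  let ?C = "orbit p c"
  have "transpose b c \<circ> p permutes insert b T" by (rule permutes_insert_new[OF p T(3)])
  then have q: "?q permutes insert a (insert b T)" by (rule permutes_insert_new) simp
  have C: "?C \<in> orbit p ` T" "?C \<subseteq> T" "finite ?C"
    using T permutes_orbit_subset[OF p T(3)] finite_subset by auto
  have new: "insert a (insert b ?C) \<notin> orbit p ` T"
    using permutes_orbit_subset[OF p] T a by blast
  have "card (orbit p ` T) > 0" using C T by (auto simp: card_gt_0_iff)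
  then have "card (insert (insert a (insert b ?C)) (orbit p ` T - {?C})) = card (orbit p ` T)"
    using C T new by (simp add: card_insert_if)
  moreover have "card (insert a (insert b ?C)) = card ?C + 2"
    using C a T by (subst card_insert_disjoint; auto)+
  then have "(\<forall>D \<in> insert (insert a (insert b ?C)) (orbit p ` T - {?C}). odd (card D)) \<longleftrightarrow>
             (\<forall>D \<in> orbit p ` T. odd (card D))"
    using C(1) by auto
  ultimately show ?thesis
    unfolding odd_cycle_perms_def orbits_insert_two[OF assms] mem_Collect_eq using p q by simp
qed

lemma odd_cycle_perms_insert_fixed:
  assumes p: "p permutes S" and S: "finite S" "a \<notin> S"
  shows "p \<in> odd_cycle_perms (insert a S) k \<longleftrightarrow> k > 0 \<and> p \<in> odd_cycle_perms S (k - 1)"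
proof -
  have oa: "orbit p a = {a}" using permutes_not_in[OF p S(2)] by (simp add: orbit_eq_singleton_iff)
  have "{a} \<notin> orbit p ` S" using permutes_orbit_subset[OF p] S by blast
  then have "card (orbit p ` insert a S) = Suc (card (orbit p ` S))"
    using S oa by simp
  moreover have "p permutes insert a S" using p by (rule permutes_subset) auto
  ultimately show ?thesis using p oa by (auto simp: odd_cycle_perms_def)
qed

text \<open>If \<open>a\<close> is not fixed, its odd cycle has length at least 3, so
  \<open>a\<close>, its image \<open>b\<close> and the image \<open>c\<close> of \<open>b\<close>
  are distinct. Undoing the two insertions then removes \<open>a\<close> and
  \<open>b\<close>.\<close>

lemma odd_cycle_perms_insert:
  assumes S: "finite S" "a \<notin> S"
  shows "odd_cycle_perms (insert a S) k =
    (if k = 0 then {} else odd_cycle_perms S (k - 1)) \<union>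
    (\<lambda>(b, c, p). transpose a b \<circ> (transpose b c \<circ> p)) `
      (SIGMA b:S. (S - {b}) \<times> odd_cycle_perms (S - {b}) k)"
  (is "?L = ?F \<union> ?\<Phi> ` ?D")
proof (intro equalityI subsetI)
  fix q assume q: "q \<in> ?L"
  then have qp: "q permutes insert a S" by (simp add: odd_cycle_perms_def)
  define b where "b = q a"
  define p where "p = transpose a b \<circ> q"
  have p: "p permutes S" unfolding p_def b_def by (rule permutes_insert_lemma[OF qp])
  have qeq: "q = transpose a b \<circ> p" by (simp add: p_def fun_eq_iff)
  show "q \<in> ?F \<union> ?\<Phi> ` ?D"
  proof (cases "b = a")
    case True
    then have "q = p" by (simp add: p_def)
    then show ?thesis using q odd_cycle_perms_insert_fixed[OF p S] by auto
  next
    case False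
    have b: "b \<in> S" using False permutes_in_image[OF qp, of a] by (simp add: b_def)
    define T where "T = S - {b}"
    have T: "S = insert b T" "b \<notin> T" "finite T" "a \<notin> T" using b S by (auto simp: T_def)
    define c where "c = p b"
    define p' where "p' = transpose b c \<circ> p"
    have p': "p' permutes T" unfolding p'_def c_def using p T(1) by (auto intro: permutes_insert_lemma)
    have peq: "p = transpose b c \<circ> p'" by (simp add: p'_def fun_eq_iff)
    have cS: "c \<in> S" using permutes_in_image[OF p] b by (simp add: c_def)
    \<comment> \<open>Otherwise \<open>a\<close> and \<open>b\<close> would form a cycle of even
      length 2.\<close>
    have "c \<noteq> b"
    proof
      assume "c = b"
      then have "orbit p b = {b}" by (simp add: c_def orbit_eq_singleton_iff)
      then have "{a, b} \<in> orbit q ` insert a S"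
        unfolding qeq using orbit_insert_new[OF p S b] by auto
      then have "odd (card {a, b})" using q by (auto simp: odd_cycle_perms_def)
      then show False using False by simp
    qed
    then have c: "c \<in> T" using cS by (simp add: T_def)
    have "p' \<in> odd_cycle_perms T k"
      using q odd_cycle_perms_insert_two[OF p' T(3,2) c T(4), of k] False
      unfolding qeq peq T(1) by auto
    then have "(b, c, p') \<in> ?D" using b c by (simp add: T_def)
    then show ?thesis unfolding qeq peq by force
  qed
next
  fix q assume "q \<in> ?F \<union> ?\<Phi> ` ?D"
  then show "q \<in> ?L"
  proof
    assume "q \<in> ?F"
    then show ?thesis
      using odd_cycle_perms_insert_fixed[OF _ S, of q k] by (auto simp: odd_cycle_perms_def split: if_splits)
  next
    assume "q \<in> ?\<Phi> ` ?D"
    then obtain b c p where *: "q = transpose a b \<circ> (transpose b c \<circ> p)" "b \<in> S" "c \<in> S - {b}"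
        "p \<in> odd_cycle_perms (S - {b}) k"
      by auto
    then have "p permutes S - {b}" by (simp add: odd_cycle_perms_def)
    from odd_cycle_perms_insert_two[OF this, of b c a k] * S
    show ?thesis by (auto simp: insert_absorb)
  qed
qed

lemma finite_odd_cycle_perms [simp]: "finite S \<Longrightarrow> finite (odd_cycle_perms S k)"
  unfolding odd_cycle_perms_def by (rule finite_subset[OF _ finite_permutations[of S]]) auto

text \<open>The decomposition is bijective: \<open>b\<close> is recovered as the image of
  \<open>a\<close>, then \<open>c\<close> as the image of \<open>b\<close> once the outer
  transposition is cancelled. Strong induction is needed since two points may disappear at
  once.\<close>

lemma card_odd_cycle_perms:
  assumes "finite S"
  shows "card (odd_cycle_perms S k) = odd_cycle_rec (card S) k"
  using assms
proof (induction "card S" arbitrary: S k rule: less_induct)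
  case (less S)
  show ?case
  proof (cases "S = {}")
    case True
    then show ?thesis by (auto simp: odd_cycle_perms_def)
  next
    case False
    then obtain a U where U: "S = insert a U" "a \<notin> U" by (meson Set.set_insert ex_in_conv)
    have fin: "finite U" using less.prems U by simp
    let ?F = "if k = 0 then {} else odd_cycle_perms U (k - 1)"
    let ?\<Phi> = "\<lambda>(b, c, p). transpose a b \<circ> (transpose b c \<circ> p)"
    let ?D = "SIGMA b:U. (U - {b}) \<times> odd_cycle_perms (U - {b}) k"
    have \<Phi>_a: "?\<Phi> (b, c, p) a = b" and \<Phi>_b: "(transpose b c \<circ> p) b = c" if "(b, c, p) \<in> ?D" for b c p
    proof -
      have "p permutes U - {b}" using that by (simp add: odd_cycle_perms_def)
      then have "p a = a" "p b = b" using U(2) by (auto intro: permutes_not_in)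
      then show "?\<Phi> (b, c, p) a = b" "(transpose b c \<circ> p) b = c"
        using that U(2) by (auto simp: transpose_def)
    qed
    have inj: "inj_on ?\<Phi> ?D"
    proof (rule inj_onI)
      fix x y assume x: "x \<in> ?D" and y: "y \<in> ?D" and eq: "?\<Phi> x = ?\<Phi> y"
      obtain b c p b' c' p' where xy: "x = (b, c, p)" "y = (b', c', p')" by (metis prod_cases3)
      have bb: "b = b'" using \<Phi>_a[of b c p] \<Phi>_a[of b' c' p'] x y eq unfolding xy by metis
      have cancel: "f = g" if "transpose u v \<circ> f = transpose u v \<circ> g" for u v and f g :: "'a \<Rightarrow> 'a"
        using that by (metis comp_assoc comp_id fun.map_id id_comp transpose_comp_involutory)
      have eq': "transpose b c \<circ> p = transpose b c' \<circ> p'"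
        using cancel[of a b] eq unfolding xy bb by simp
      then have cc: "c = c'" using \<Phi>_b[of b c p] \<Phi>_b[of b' c' p'] x y unfolding xy bb by metis
      have "p = p'" using cancel[of b c] eq' cc by simp
      then show "x = y" using bb cc xy by simp
    qed
    have disj: "?F \<inter> ?\<Phi> ` ?D = {}"
    proof -
      have "q a = a" if "q \<in> ?F" for q
        using that U(2) by (auto simp: odd_cycle_perms_def split: if_splits intro: permutes_not_in)
      moreover have "?\<Phi> x a \<in> U" if "x \<in> ?D" for x
        using that \<Phi>_a by (cases x) auto
      ultimately show ?thesis using U(2) by fastforce
    qed
    have "card (odd_cycle_perms S k) = card ?F + card ?D"
      unfolding U(1) odd_cycle_perms_insert[OF fin U(2)]
      using fin disj card_image[OF inj] by (subst card_Un_disjoint) auto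
    also have "card ?D = (\<Sum>b\<in>U. (card U - 1) * odd_cycle_rec (card U - 1) k)"
      using fin U less.hyps[of "U - {_}" k]
      by (subst card_SigmaI) (auto simp: card_cartesian_product intro!: sum.cong)
    also have "card ?F = (if k = 0 then 0 else odd_cycle_rec (card U) (k - 1))"
      using less.hyps[of U "k - 1"] U fin by simp
    finally show ?thesis using U fin by simp
  qed
qed

lemma odd_cycle_number_eq: "odd_cycle_number n k = odd_cycle_rec n k"
  using card_odd_cycle_perms[of "{1..n}" k]
  unfolding odd_cycle_number_def cycle_sets_def odd_cycle_perms_def by simp

lemma odd_cycle_rec_nonzero: "odd_cycle_rec n k \<noteq> 0 \<Longrightarrow> k \<le> n \<and> even (n - k)"
proof (induction n k rule: odd_cycle_rec.induct)
  case (2 n k)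
  consider "k \<noteq> 0" "odd_cycle_rec n (k - 1) \<noteq> 0" | "n \<ge> 2" "odd_cycle_rec (n - 1) k \<noteq> 0"
    using "2.prems" by (cases "n \<ge> 2") (auto split: if_splits)
  then show ?case
  proof cases
    case 1
    then show ?thesis using "2.IH"(1) by auto
  next
    case 2
    then have "k \<le> n - 1 \<and> even (n - 1 - k)" using "2.IH"(2) by blast
    then show ?thesis using 2 by (cases n) (auto simp: Suc_diff_le)
  qed
qed (auto split: if_splits)

text \<open>Removes the summand \<open>k = 0\<close>, which \<open>peak_poly_cayley\<close> does not
  cover.\<close>

lemma odd_cycle_rec_0: "n \<ge> 1 \<Longrightarrow> odd_cycle_rec n 0 = 0"
proof (induction n rule: less_induct)
  case (less n)
  then show ?case by (cases n; cases "n \<ge> 3") auto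
qed

section \<open>Enriched partitions of the identity permutation\<close>

lemma cayley_nonzero [simp]: "cayley \<noteq> 0"
  using cayley_mult by auto

text \<open>This differential equation yields a recurrence in the word length matching the one for
  odd cycles.\<close>

lemma deriv_cayley: "(1 - fps_X ^ 2) * fps_deriv cayley = 2 * cayley"
proof -
  have "fps_deriv ((1 - fps_X) * cayley) = fps_deriv (1 + fps_X)" by (simp only: cayley_mult)
  then have *: "(1 - fps_X) * fps_deriv cayley = 1 + cayley" by (simp add: algebra_simps)
  have "(1 - fps_X ^ 2) * fps_deriv cayley = (1 + fps_X) * ((1 - fps_X) * fps_deriv cayley)"
    by (simp add: algebra_simps power2_eq_square)
  also have "\<dots> = (1 + fps_X) + (1 + fps_X) * cayley"
    unfolding * by (simp add: algebra_simps)
  also have "\<dots> = (1 - fps_X) * cayley + (1 + fps_X) * cayley" by (simp only: cayley_mult)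
  also have "\<dots> = 2 * cayley" by (simp add: algebra_simps)
  finally show ?thesis .
qed

text \<open>Here the variable marks the length \<open>n\<close>. Adding a largest negative letter,
  used at most once, and a largest positive one, used arbitrarily often, multiplies the series by
  \<open>(1 + x) / (1 - x)\<close>.\<close>

lemma enriched_count_id_gf: "Abs_fps (\<lambda>n. of_nat (enriched_count (\<lambda>i. i) n (2 * m))) = cayley ^ m"
proof (induction m)
  case 0
  show ?case
  proof (rule fps_ext)
    fix n
    show "fps_nth (Abs_fps (\<lambda>n. of_nat (enriched_count (\<lambda>i. i) n (2 * 0)))) n = fps_nth (cayley ^ 0) n"
      by (cases n) auto
  qed
next
  case (Suc m)
  let ?F = "\<lambda>m. Abs_fps (\<lambda>n. of_nat (enriched_count (\<lambda>i. i) n (2 * m))) :: rat fps"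
  have "(1 - fps_X) * ?F (Suc m) = (1 + fps_X) * ?F m"
  proof (rule fps_ext)
    fix n
    show "fps_nth ((1 - fps_X) * ?F (Suc m)) n = fps_nth ((1 + fps_X) * ?F m) n"
      by (cases n) (simp_all add: algebra_simps)
  qed
  also have "\<dots> = (1 - fps_X) * cayley ^ Suc m"
    unfolding Suc.IH by (simp only: cayley_mult[symmetric] power_Suc mult.assoc)
  finally show ?case by (simp only: mult_cancel_left) simp
qed

text \<open>Coefficient comparison in \<open>(1 - x ^ 2) * F' = 2 * m * F\<close> for
  \<open>F = cayley ^ m\<close>. At \<open>n = 0\<close> the truncated \<open>n - 1\<close> gives a
  zero factor, as required.\<close>

lemma enriched_count_id_rec:
  fixes m :: nat
  defines "c \<equiv> \<lambda>n. of_nat (enriched_count (\<lambda>i. i) n (2 * m)) :: rat"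
  shows "of_nat (Suc n) * c (Suc n) = 2 * of_nat m * c n + of_nat (n - 1) * c (n - 1)"
proof -
  have c: "c n = fps_nth (cayley ^ m) n" for n
    by (simp add: c_def enriched_count_id_gf[symmetric])
  have "(1 - fps_X ^ 2) * fps_deriv (cayley ^ m) = of_nat (2 * m) * cayley ^ m"
  proof (cases m)
    case (Suc l)
    have "(1 - fps_X ^ 2) * fps_deriv (cayley ^ m) =
        of_nat m * (((1 - fps_X ^ 2) * fps_deriv cayley) * cayley ^ l)"
      by (simp only: fps_deriv_power fps_of_nat Suc diff_Suc_1 mult_ac)
    also have "\<dots> = of_nat (2 * m) * cayley ^ m"
      unfolding deriv_cayley by (simp add: Suc)
    finally show ?thesis .
  qed simp
  then have "fps_nth (fps_deriv (cayley ^ m)) n - fps_nth (fps_X ^ 2 * fps_deriv (cayley ^ m)) n =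
      2 * of_nat m * c n"
    by (simp add: left_diff_distrib c fps_eq_iff fps_of_nat[symmetric] del: fps_deriv_nth)
  moreover have "fps_nth (fps_X ^ 2 * fps_deriv (cayley ^ m)) n = of_nat (n - 1) * c (n - 1)"
  proof (cases "n < 2")
    case True
    then show ?thesis by (auto simp only: fps_X_power_mult_nth less_2_cases_iff) simp_all
  next
    case False
    then obtain l where "n = Suc (Suc l)" by (metis One_nat_def Suc_1 less_Suc0 less_Suc_eq not0_implies_Suc old.nat.exhaust)
    then show ?thesis by (simp only: fps_X_power_mult_nth c) (simp add: fps_deriv_nth)
  qed
  ultimately show ?thesis by (simp add: c)
qed

text \<open>After multiplication by \<open>fact n\<close>, both sides satisfy
  \<open>s (l + 1) = y * s l + l * (l - 1) * s (l - 1)\<close> with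
  \<open>y = 2 * m\<close>.\<close>

lemma enriched_count_id_eq:
  "fact n * of_nat (enriched_count (\<lambda>i. i) n (2 * m)) =
     (\<Sum>k\<le>n. of_nat (odd_cycle_rec n k) * (2 * of_nat m) ^ k :: rat)"
proof (induction n rule: less_induct)
  case (less n)
  define c where "c = (\<lambda>n. of_nat (enriched_count (\<lambda>i. i) n (2 * m)) :: rat)"
  define y where "y = (2 * of_nat m :: rat)"
  define s where "s = (\<lambda>n. \<Sum>k\<le>n. of_nat (odd_cycle_rec n k) * y ^ k)"
  have IH: "fact l * c l = s l" if "l < n" for l
    using less[OF that] by (simp add: c_def s_def y_def)
  show ?case
  proof (cases n)
    case 0
    then show ?thesis by simp
  next
    case (Suc l)
    \<comment> \<open>The recurrence needs \<open>s (l - 1)\<close> summed up to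
      \<open>Suc l\<close>; the added terms vanish by \<open>odd_cycle_rec_nonzero\<close>.\<close>
    have s_ext: "s l = (\<Sum>k\<le>N. of_nat (odd_cycle_rec l k) * y ^ k)" if "l \<le> N" for l N
      unfolding s_def
      by (rule sum.mono_neutral_left) (use that odd_cycle_rec_nonzero[of l] in force)+
    have "s n = (\<Sum>k\<le>Suc l. (if k = 0 then 0 else of_nat (odd_cycle_rec l (k - 1)) * y ^ k)) +
        of_nat (l * (l - 1)) * (\<Sum>k\<le>Suc l. of_nat (odd_cycle_rec (l - 1) k) * y ^ k)"
      unfolding s_def Suc odd_cycle_rec.simps(2) sum_distrib_left sum.distrib[symmetric]
      by (rule sum.cong) (auto simp: distrib_right mult.assoc)
    also have "(\<Sum>k\<le>Suc l. (if k = 0 then 0 else of_nat (odd_cycle_rec l (k - 1)) * y ^ k)) = y * s l"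
      by (subst sum.atMost_Suc_shift) (simp add: s_def sum_distrib_left mult_ac)
    also have "(\<Sum>k\<le>Suc l. of_nat (odd_cycle_rec (l - 1) k) * y ^ k) = s (l - 1)"
      by (rule s_ext[symmetric]) simp
    also have "y * s l + of_nat (l * (l - 1)) * s (l - 1) = fact l * (y * c l + of_nat (l - 1) * c (l - 1))"
    proof -
      have "s l = fact l * c l" "s (l - 1) = fact (l - 1) * c (l - 1)"
        using IH[of l] IH[of "l - 1"] Suc by simp_all
      then show ?thesis by (cases l) (simp_all add: algebra_simps)
    qed
    also have "\<dots> = fact l * (of_nat (Suc l) * c (Suc l))"
      using enriched_count_id_rec[of l m] by (simp add: c_def y_def)
    also have "\<dots> = fact n * c n" by (simp add: Suc algebra_simps)
    finally show ?thesis by (simp add: s_def c_def y_def)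
  qed
qed

section \<open>From counts to polynomials\<close>

lemma hom_sum:
  assumes "\<phi> 0 = 0" "\<And>a b. \<phi> (a + b) = \<phi> a + \<phi> b"
  shows "\<phi> (\<Sum>x\<in>A. f x) = (\<Sum>x\<in>A. \<phi> (f x))"
  by (induction A rule: infinite_finite_induct) (simp_all add: assms)

lemma hom_power:
  fixes \<phi> :: "'a :: comm_semiring_1 \<Rightarrow> 'b :: comm_semiring_1"
  assumes "\<phi> 1 = 1" "\<And>a b. \<phi> (a * b) = \<phi> a * \<phi> b"
  shows "\<phi> (a ^ n) = \<phi> a ^ n"
  by (induction n) (simp_all add: assms)

text \<open>Serves both for substituting \<open>peak_arg\<close> into polynomials and for evaluating
  them at numbers.\<close>

lemma peak_poly_hom:
  fixes \<phi> :: "'a :: comm_semiring_1 \<Rightarrow> 'b :: comm_semiring_1"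
  assumes "\<phi> 0 = 0" "\<phi> 1 = 1" "\<And>a b. \<phi> (a + b) = \<phi> a + \<phi> b" "\<And>a b. \<phi> (a * b) = \<phi> a * \<phi> b"
  shows "\<phi> (peak_poly k t) = peak_poly k (\<phi> t)"
  by (simp add: peak_poly_def assms hom_sum[of \<phi>] hom_power[of \<phi>])

text \<open>Sum of \<open>even_gf_eq\<close> over all permutations. It fails at
  \<open>k = 0\<close>, where \<open>peak_poly\<close> is 1 by convention.\<close>

lemma peak_poly_cayley:
  assumes "k \<ge> 1"
  shows "Abs_fps (\<lambda>i. 2 * (2 * of_nat i) ^ k) = cayley ^ Suc k * peak_poly k peak_arg"
proof -
  have "(\<Sum>\<pi> | \<pi> permutes {1..k}. 2 * even_gf \<pi> k) = cayley ^ Suc k * peak_poly k peak_arg"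
    using assms by (simp add: even_gf_eq peak_poly_def sum_distrib_left)
  moreover have "(\<Sum>\<pi> | \<pi> permutes {1..k}. 2 * even_gf \<pi> k) = Abs_fps (\<lambda>i. 2 * (2 * of_nat i) ^ k)"
  proof (rule fps_ext)
    fix i
    have "fps_nth (\<Sum>\<pi> | \<pi> permutes {1..k}. 2 * even_gf \<pi> k) i =
        2 * of_nat (\<Sum>\<pi> | \<pi> permutes {1..k}. enriched_count \<pi> k (2 * i))"
      by (simp add: fps_sum_nth even_gf_def sum_distrib_left numeral_fps_const)
    also have "\<dots> = 2 * (2 * of_nat i) ^ k"
      unfolding sum_enriched_count by simp
    finally show "fps_nth (\<Sum>\<pi> | \<pi> permutes {1..k}. 2 * even_gf \<pi> k) i =
        fps_nth (Abs_fps (\<lambda>i. 2 * (2 * of_nat i) ^ k)) i" by simp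
  qed
  ultimately show ?thesis by simp
qed

text \<open>Rests on \<open>(1 + x) ^ 2 - 4 * x = (1 - x) ^ 2\<close>. It is the source of the
  powers of \<open>1 - s\<close> and \<open>1 - t\<close>.\<close>

lemma cayley_peak_arg: "cayley ^ 2 * (1 - peak_arg) = 1"
proof -
  let ?m = "(1 - fps_X) ^ 2 :: rat fps"
  have "?m * (cayley ^ 2 * (1 - peak_arg)) = ((1 - fps_X) * cayley) ^ 2 * (1 - peak_arg)"
    by (simp only: power_mult_distrib mult.assoc)
  also have "\<dots> = (1 + fps_X) ^ 2 - 4 * fps_X"
    by (simp only: cayley_mult right_diff_distrib peak_arg_mult mult_1_right)
  also have "\<dots> = ?m * 1" by (simp add: power2_eq_square algebra_simps)
  finally show ?thesis by (simp only: mult_cancel_left) simp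
qed

text \<open>The constant term of the composite forces the constant coefficient to vanish; then one
  factor \<open>S\<close> cancels and the induction continues.\<close>

lemma fps_of_poly_compose_eq_0:
  fixes q :: "rat poly"
  assumes "fps_of_poly q oo S = 0" "fps_nth S 0 = 0" "S \<noteq> 0"
  shows "q = 0"
  using assms(1)
proof (induction q)
  case (pCons a q)
  have *: "fps_const a + (fps_of_poly q oo S) * S = 0"
    using pCons.prems assms(2)
    by (simp add: fps_of_poly_pCons fps_compose_add_distrib fps_compose_mult_distrib)
  then have "fps_nth (fps_const a + (fps_of_poly q oo S) * S) 0 = 0" by simp
  then have "a = 0" using assms(2) by simp
  then show ?case using * pCons assms(3) by simp
qed simp

text \<open>Trades one counting variable \<open>i\<close> for one polynomial variable
  \<open>x\<close>. The weights \<open>u\<close> and \<open>v\<close> carry the other variable, so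
  that two applications give the bivariate identity.\<close>

lemma peak_identity_of_counts:
  fixes u :: "'b \<Rightarrow> rat" and v :: "nat \<Rightarrow> rat"
  assumes eq: "\<And>i. (\<Sum>a\<in>A. u a * fps_nth (cayley ^ Suc n * peak_arg ^ Suc (p a)) i) =
                    (\<Sum>k=1..n. v k * (2 * (2 * of_nat i) ^ k))"
    and v: "\<And>k. v k \<noteq> 0 \<Longrightarrow> even (n - k)"
  shows "(\<Sum>a\<in>A. u a * x ^ Suc (p a)) = (\<Sum>k=1..n. v k * (1 - x) ^ ((n - k) div 2) * peak_poly k x)"
proof -
  \<comment> \<open>The difference of the two sides in an indeterminate; it vanishes because it does
    so at \<open>peak_arg\<close>.\<close>
  define q where "q = (\<Sum>a\<in>A. [:u a:] * [:0, 1:] ^ Suc (p a)) -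
     (\<Sum>k=1..n. [:v k:] * (1 - [:0, 1:]) ^ ((n - k) div 2) * peak_poly k [:0, 1:])"
  define \<phi> where "\<phi> = (\<lambda>q :: rat poly. fps_of_poly q oo peak_arg)"
  have S0: "fps_nth peak_arg 0 = 0" by (simp add: peak_arg_def)
  have S: "peak_arg \<noteq> 0" using peak_arg_mult by auto
  have \<phi>: "\<phi> 0 = 0" "\<phi> 1 = 1" "\<And>a b. \<phi> (a + b) = \<phi> a + \<phi> b" "\<And>a b. \<phi> (a * b) = \<phi> a * \<phi> b"
    "\<And>a b. \<phi> (a - b) = \<phi> a - \<phi> b" "\<And>c. \<phi> [:c:] = fps_const c" "\<phi> [:0, 1:] = peak_arg"
    using S0 by (simp_all add: \<phi>_def fps_of_poly_add fps_of_poly_mult fps_of_poly_diff fps_compose_add_distrib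
        fps_compose_mult_distrib fps_compose_sub_distrib fps_of_poly_pCons)
  note \<phi>_sum = hom_sum[of \<phi>, OF \<phi>(1,3)] and \<phi>_power = hom_power[of \<phi>, OF \<phi>(2,4)]
    and \<phi>_peak = peak_poly_hom[of \<phi>, OF \<phi>(1-4)]
  have "cayley ^ Suc n * (\<Sum>a\<in>A. fps_const (u a) * peak_arg ^ Suc (p a)) =
      Abs_fps (\<lambda>i. \<Sum>a\<in>A. u a * fps_nth (cayley ^ Suc n * peak_arg ^ Suc (p a)) i)"
    by (rule fps_ext) (simp add: sum_distrib_left fps_sum_nth mult.left_commute[of _ "fps_const _"] del: power_Suc)
  also have "\<dots> = (\<Sum>k=1..n. fps_const (v k) * Abs_fps (\<lambda>i. 2 * (2 * of_nat i) ^ k))"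
    unfolding eq by (rule fps_ext) (simp add: fps_sum_nth)
  also have "\<dots> = (\<Sum>k=1..n. cayley ^ Suc n *
      (fps_const (v k) * (1 - peak_arg) ^ ((n - k) div 2) * peak_poly k peak_arg))"
  proof (rule sum.cong[OF refl])
    fix k assume k: "k \<in> {1..n}"
    show "fps_const (v k) * Abs_fps (\<lambda>i. 2 * (2 * of_nat i) ^ k) = cayley ^ Suc n *
      (fps_const (v k) * (1 - peak_arg) ^ ((n - k) div 2) * peak_poly k peak_arg)"
    proof (cases "v k = 0")
      case False
      then obtain d where d: "n - k = 2 * d" using v by blast
      \<comment> \<open>The surplus \<open>cayley ^ (2 * d)\<close> cancels against
        \<open>(1 - peak_arg) ^ d\<close>.\<close>
      then have "Suc n = Suc k + 2 * d" using k by auto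
      then have "cayley ^ Suc n * (1 - peak_arg) ^ ((n - k) div 2) =
          cayley ^ Suc k * (cayley ^ 2 * (1 - peak_arg)) ^ d"
        using d by (simp only: power_add power_mult power_mult_distrib mult.assoc) simp
      then have *: "cayley ^ Suc n * (1 - peak_arg) ^ ((n - k) div 2) = cayley ^ Suc k"
        by (simp only: cayley_peak_arg power_one mult_1_right)
      have "cayley ^ Suc n * (fps_const (v k) * (1 - peak_arg) ^ ((n - k) div 2) * peak_poly k peak_arg) =
        fps_const (v k) * ((cayley ^ Suc n * (1 - peak_arg) ^ ((n - k) div 2)) * peak_poly k peak_arg)"
        by (simp only: mult_ac)
      then show ?thesis using k unfolding * by (simp only: peak_poly_cayley atLeastAtMost_iff)
    qed simp
  qed
  finally have "(\<Sum>a\<in>A. fps_const (u a) * peak_arg ^ Suc (p a)) =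
      (\<Sum>k=1..n. fps_const (v k) * (1 - peak_arg) ^ ((n - k) div 2) * peak_poly k peak_arg)"
    unfolding sum_distrib_left[symmetric] by simp
  then have "\<phi> q = 0"
    unfolding q_def \<phi>(5) \<phi>_sum \<phi>(4) \<phi>_power \<phi>_peak \<phi>(5) \<phi>(2) \<phi>(6,7) by simp
  then have "q = 0" unfolding \<phi>_def using S0 S by (rule fps_of_poly_compose_eq_0)
  then have "poly q x = 0" by simp
  moreover have "poly (peak_poly k [:0, 1:]) x = peak_poly k x" for k
    using peak_poly_hom[of "\<lambda>q. poly q x" k "[:0, 1:]"] by simp
  ultimately show ?thesis by (simp add: q_def poly_sum mult_ac)
qed

lemma pk_ipk_poly_rat:
  fixes x y :: rat
  assumes n: "n \<ge> 1"
  shows "pk_ipk_poly n x y = (\<Sum>k=1..n. of_nat (odd_cycle_number n k) / fact n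
     * ((1 - x) * (1 - y)) ^ ((n - k) div 2) * peak_poly k x * peak_poly k y)"
proof -
  define d where "d = (\<lambda>k. of_nat (odd_cycle_rec n k) / fact n :: rat)"
  let ?S = "{\<pi>. \<pi> permutes {1..n}}"
  \<comment> \<open>Twice the series \<open>even_gf\<close> of any permutation with \<open>p\<close>
    peaks; these doublings produce the factor 4 below.\<close>
  define w where "w = (\<lambda>p. cayley ^ Suc n * peak_arg ^ Suc p)"
  have w: "fps_nth (w (pk n \<pi>)) i = 2 * of_nat (enriched_count \<pi> n (2 * i))" if "\<pi> \<in> ?S" for \<pi> i
  proof -
    have "w (pk n \<pi>) = 2 * even_gf \<pi> n" using even_gf_eq[OF n] that by (simp add: w_def)
    then show ?thesis by (simp add: even_gf_def numeral_fps_const)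
  qed
  have d: "even (n - k)" if "d k \<noteq> 0" for k
    using that odd_cycle_rec_nonzero[of n k] by (auto simp: d_def)
  have counts: "(\<Sum>\<pi>\<in>?S. fps_nth (w (ipk n \<pi>)) j * fps_nth (w (pk n \<pi>)) i) =
      (\<Sum>k=1..n. (d k * (2 * (2 * of_nat j) ^ k)) * (2 * (2 * of_nat i) ^ k))" for i j
  proof -
    have "(\<Sum>\<pi>\<in>?S. fps_nth (w (ipk n \<pi>)) j * fps_nth (w (pk n \<pi>)) i) =
        4 * of_nat (\<Sum>\<pi>\<in>?S. enriched_count \<pi> n (2 * i) * enriched_count (inv \<pi>) n (2 * j))"
      unfolding ipk_def of_nat_sum sum_distrib_left
      by (rule sum.cong) (auto simp: w permutes_inv)
    also have "(\<Sum>\<pi>\<in>?S. enriched_count \<pi> n (2 * i) * enriched_count (inv \<pi>) n (2 * j)) =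
        enriched_count (\<lambda>i. i) n (2 * (2 * i * j))"
      using sum_enriched_count_inv[of "2 * i" n "2 * j"] by (simp add: mult_ac)
    also have "of_nat \<dots> = (\<Sum>k\<le>n. d k * (2 * of_nat (2 * i * j)) ^ k)"
      using enriched_count_id_eq[of n "2 * i * j"]
      by (simp add: d_def sum_divide_distrib[symmetric] field_simps)
    also have "\<dots> = (\<Sum>k=1..n. d k * (2 * of_nat (2 * i * j)) ^ k)"
      by (rule sum.mono_neutral_right) (use odd_cycle_rec_0[OF n] in \<open>auto simp: d_def not_less_eq_eq\<close>)
    finally have "(\<Sum>\<pi>\<in>?S. fps_nth (w (ipk n \<pi>)) j * fps_nth (w (pk n \<pi>)) i) =
        4 * (\<Sum>k=1..n. d k * (2 * of_nat (2 * i * j)) ^ k)" .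
    also have "\<dots> = (\<Sum>k=1..n. (d k * (2 * (2 * of_nat j) ^ k)) * (2 * (2 * of_nat i) ^ k))"
      unfolding sum_distrib_left
    proof (rule sum.cong[OF refl])
      fix k
      have "(2 * of_nat (2 * i * j)) ^ k = (2 * of_nat j :: rat) ^ k * (2 * of_nat i) ^ k"
        unfolding power_mult_distrib[symmetric] by (simp add: mult.commute)
      then show "4 * (d k * (2 * of_nat (2 * i * j)) ^ k) =
          (d k * (2 * (2 * of_nat j) ^ k)) * (2 * (2 * of_nat i) ^ k)"
        by simp
    qed
    finally show ?thesis .
  qed
  \<comment> \<open>With \<open>j\<close> fixed, \<open>i\<close> is traded for \<open>x\<close>,
    and the coefficients indexed by \<open>j\<close> act as weights.\<close>
  have half: "(\<Sum>\<pi>\<in>?S. fps_nth (w (ipk n \<pi>)) j * x ^ Suc (pk n \<pi>)) =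
      (\<Sum>k=1..n. (d k * (2 * (2 * of_nat j) ^ k)) * (1 - x) ^ ((n - k) div 2) * peak_poly k x)" for j
  proof (rule peak_identity_of_counts)
    show "(\<Sum>\<pi>\<in>?S. fps_nth (w (ipk n \<pi>)) j * fps_nth (cayley ^ Suc n * peak_arg ^ Suc (pk n \<pi>)) i) =
      (\<Sum>k=1..n. (d k * (2 * (2 * of_nat j) ^ k)) * (2 * (2 * of_nat i) ^ k))" for i
      using counts[of j i] by (simp only: w_def)
  qed (use d in auto)
  \<comment> \<open>Now \<open>j\<close> is traded for \<open>y\<close>, with the powers of
    \<open>x\<close> as weights.\<close>
  have "(\<Sum>\<pi>\<in>?S. x ^ Suc (pk n \<pi>) * y ^ Suc (ipk n \<pi>)) =
      (\<Sum>k=1..n. (d k * (1 - x) ^ ((n - k) div 2) * peak_poly k x) * (1 - y) ^ ((n - k) div 2) * peak_poly k y)"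
  proof (rule peak_identity_of_counts)
    show "(\<Sum>\<pi>\<in>?S. x ^ Suc (pk n \<pi>) * fps_nth (cayley ^ Suc n * peak_arg ^ Suc (ipk n \<pi>)) j) =
      (\<Sum>k=1..n. (d k * (1 - x) ^ ((n - k) div 2) * peak_poly k x) * (2 * (2 * of_nat j) ^ k))" for j
      using half[of j] by (simp only: w_def mult_ac)
  qed (use d in auto)
  then show ?thesis
    by (simp add: pk_ipk_poly_def d_def odd_cycle_number_eq power_mult_distrib mult_ac)
qed

text \<open>If \<open>p\<close> and \<open>q\<close> differed, \<open>p - q\<close> would have every
  constant \<open>[:y:]\<close> as a root, and there are infinitely many of them.\<close>

lemma poly_poly_eqI:
  fixes p q :: "'a :: {idom, ring_char_0} poly poly"
  assumes "\<And>x y. poly (poly p [:y:]) x = poly (poly q [:y:]) x"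
  shows "p = q"
proof (rule ccontr)
  assume "p \<noteq> q"
  then have "finite {z. poly (p - q) z = 0}" by (intro poly_roots_finite) simp
  moreover have "poly (p - q) [:y:] = 0" for y
    using assms[of y] by (simp add: poly_eq_poly_eq_iff[symmetric] fun_eq_iff)
  then have "range (\<lambda>y. [:y:]) \<subseteq> {z. poly (p - q) z = 0}" by blast
  ultimately have "finite (range (\<lambda>y::'a. [:y:]))" using finite_subset by blast
  then have "finite (UNIV :: 'a set)" by (rule finite_imageD) (simp add: inj_on_def)
  then show False using infinite_UNIV_char_0 by blast
qed

theorem theorem3p4:
  fixes n :: nat
  assumes "n \<ge> 1"
  shows "pk_ipk_poly n var_s var_t =
    smult [:1 / fact n:]
      (\<Sum>k = 0..n. of_nat (odd_cycle_number n k)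
         * ((1 - var_s) * (1 - var_t)) ^ ((n - k) div 2)
         * peak_poly k var_s * peak_poly k var_t)"
proof (rule poly_poly_eqI)
  fix x y :: rat
  \<comment> \<open>The outer indeterminate is \<open>var_t\<close>, so it is evaluated first, at
    the constant polynomial \<open>[:y:]\<close>; then \<open>var_s\<close> is evaluated at
    \<open>x\<close>.\<close>
  define \<phi> where "\<phi> = (\<lambda>p :: rat poly poly. poly (poly p [:y:]) x)"
  have \<phi>: "\<phi> 0 = 0" "\<phi> 1 = 1" "\<And>a b. \<phi> (a + b) = \<phi> a + \<phi> b" "\<And>a b. \<phi> (a * b) = \<phi> a * \<phi> b"
    "\<And>a b. \<phi> (a - b) = \<phi> a - \<phi> b" "\<And>c p. \<phi> (smult [:c:] p) = c * \<phi> p" "\<phi> var_s = x" "\<phi> var_t = y"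
    "\<And>m. \<phi> (of_nat m) = of_nat m"
    by (simp_all add: \<phi>_def var_s_def var_t_def)
  note \<phi>_sum = hom_sum[of \<phi>, OF \<phi>(1,3)] and \<phi>_power = hom_power[of \<phi>, OF \<phi>(2,4)]
    and \<phi>_peak = peak_poly_hom[of \<phi>, OF \<phi>(1-4)]
  have "\<phi> (pk_ipk_poly n var_s var_t) = pk_ipk_poly n x y"
    by (simp add: pk_ipk_poly_def \<phi> \<phi>_sum \<phi>_power)
  also have "\<dots> = 1 / fact n * (\<Sum>k = 1..n. of_nat (odd_cycle_number n k)
         * ((1 - x) * (1 - y)) ^ ((n - k) div 2) * peak_poly k x * peak_poly k y)"
    unfolding pk_ipk_poly_rat[OF assms] sum_distrib_left by (intro sum.cong refl) simp
  \<comment> \<open>The summand \<open>k = 0\<close> vanishes, as a nonempty set has no permutation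
    without cycles.\<close>
  also have "\<dots> = 1 / fact n * (\<Sum>k = 0..n. of_nat (odd_cycle_number n k)
         * ((1 - x) * (1 - y)) ^ ((n - k) div 2) * peak_poly k x * peak_poly k y)"
    using assms by (simp add: sum.atLeast_Suc_atMost[of 0 n] odd_cycle_number_eq odd_cycle_rec_0)
  also have "\<dots> = \<phi> (smult [:1 / fact n:]
      (\<Sum>k = 0..n. of_nat (odd_cycle_number n k)
         * ((1 - var_s) * (1 - var_t)) ^ ((n - k) div 2)
         * peak_poly k var_s * peak_poly k var_t))"
    unfolding \<phi>(6) \<phi>_sum \<phi>(4) \<phi>_power \<phi>_peak \<phi>(4,5) \<phi>(2,7-9) ..
  finally show "poly (poly (pk_ipk_poly n var_s var_t) [:y:]) x =
     poly (poly (smult [:1 / fact n:]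
      (\<Sum>k = 0..n. of_nat (odd_cycle_number n k)
         * ((1 - var_s) * (1 - var_t)) ^ ((n - k) div 2)
         * peak_poly k var_s * peak_poly k var_t)) [:y:]) x"
    unfolding \<phi>_def .
qed

end
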